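(* Let $R>0$ and let $\mathcal{GH}_{\leq R}^{<\omega}$ be the space of isometry classes of finite metric spaces of diameter at most $R$, endowed with the Gromov-Hausdorff distance. Then $\mathcal{GH}_{\leq R}^{<\omega}$ cannot be bi-Lipschitz embedded into any finite-dimensional Hilbert space.
   Context: Metric spaces are nonempty. A correspondence between sets $X,Y$ is a relation $\mathcal{R}\subseteq X\times Y$ such that every $x\in X$ is related to at least one $y\in Y$ and vice versa. For a metric space $(Z,d)$ and $X,Y\subseteq Z$, the Hausdorff distance is $d_H(X,Y)=\inf_{\mathcal{R}\subseteq X\times Y\text{ correspondence}}\sup_{(x,y)\in\mathcal{R}}d(x,y)$. The Gromov-Hausdorff distance $d_{GH}(X,Y)$ of two metric spaces is the infimum of $d_H(i_X(X),i_Y(Y))$ over all metric spaces $Z$ and isometric embeddings $i_X\colon X\to Z$, $i_Y\colon Y\to Z$. Equivalently, $d_{GH}(X,Y)=\frac12\inf_{\mathcal{R}}\sup_{(x_1,y_1),(x_2,y_2)\in\mathcal{R}}|d_X(x_1,x_2)-d_Y(y_1,y_2)|$ over correspondences $\mathcal{R}$. The distance between isometry classes is the distance between representatives; $d_{GH}$ is a metric on isometry classes of finite metric spaces. A map $\psi\colon(X,d_X)\to(Y,d_Y)$ between metric spaces is a bi-Lipschitz embedding if there are constants $a,b>0$ with $a\,d_X(x,y)\le d_Y(\psi(x),\psi(y))\le b\,d_X(x,y)$ for all $x,y\in X$. *)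

theory Defs
  imports "HOL-Analysis.Analysis"
begin

section \<open>Hausdorff and Gromov-Hausdorff distance\<close>

definition correspondence :: "('a \<times> 'b) set \<Rightarrow> 'a set \<Rightarrow> 'b set \<Rightarrow> bool" where
  "correspondence r A B \<longleftrightarrow>
     r \<subseteq> A \<times> B \<and> (\<forall>x\<in>A. \<exists>y\<in>B. (x, y) \<in> r) \<and> (\<forall>y\<in>B. \<exists>x\<in>A. (x, y) \<in> r)"

text \<open>The distances below are real valued. They are meant for nonempty bounded spaces, where all
  the suprema and infima involved are over nonempty bounded sets of reals.\<close>

definition hausdorff_dist :: "('a \<Rightarrow> 'a \<Rightarrow> real) \<Rightarrow> 'a set \<Rightarrow> 'a set \<Rightarrow> real" where
  "hausdorff_dist d A B = (INF r\<in>{r. correspondence r A B}. SUP (x, y)\<in>r. d x y)"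

definition isometric_embedding :: "'a metric \<Rightarrow> 'b metric \<Rightarrow> ('a \<Rightarrow> 'b) \<Rightarrow> bool" where
  "isometric_embedding X Y f \<longleftrightarrow> f \<in> mspace X \<rightarrow> mspace Y \<and>
     (\<forall>x\<in>mspace X. \<forall>y\<in>mspace X. mdist Y (f x) (f y) = mdist X x y)"

text \<open>The ambient space Z has its points in the sum type. This is no restriction: by the lemma
  \<open>ambient_in_sum_type\<close> below, an ambient space over any other type contributes
  no further values to the infimum.\<close>

definition GH_dist :: "'a metric \<Rightarrow> 'b metric \<Rightarrow> real" where
  "GH_dist X Y = Inf {hausdorff_dist (mdist Z) (f ` mspace X) (g ` mspace Y) |
     (Z :: ('a + 'b) metric) f g. isometric_embedding X Z f \<and> isometric_embedding Y Z g}"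

lemma hausdorff_dist_image:
  assumes inj: "inj_on h (A \<union> B)"
    and d: "\<And>x y. x \<in> A \<Longrightarrow> y \<in> B \<Longrightarrow> d' (h x) (h y) = d x y"
  shows "hausdorff_dist d' (h ` A) (h ` B) = hausdorff_dist d A B"
proof -
  let ?F = "\<lambda>r. map_prod h h ` r"
  have sup: "(SUP (x, y)\<in>?F r. d' x y) = (SUP (x, y)\<in>r. d x y)" if "correspondence r A B" for r
  proof -
    have "(\<lambda>(x, y). d' x y) ` ?F r = (\<lambda>(x, y). d x y) ` r"
      unfolding image_image
      by (rule image_cong) (use that d in \<open>auto simp: correspondence_def\<close>)
    then show ?thesis by simp
  qed
  have corr: "{r. correspondence r (h ` A) (h ` B)} = ?F ` {r. correspondence r A B}"
  proof (intro set_eqI iffI)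
    fix s assume "s \<in> {r. correspondence r (h ` A) (h ` B)}"
    then have s: "correspondence s (h ` A) (h ` B)" by simp
    define r where "r = {(x, y). x \<in> A \<and> y \<in> B \<and> (h x, h y) \<in> s}"
    have "correspondence r A B"
      using s unfolding correspondence_def r_def by blast
    moreover have "s = ?F r"
    proof (intro equalityI subsetI)
      fix p assume p: "p \<in> s"
      then obtain x y where "p = (h x, h y)" "x \<in> A" "y \<in> B"
        using s unfolding correspondence_def by blast
      then show "p \<in> ?F r"
        using p unfolding r_def by force
    qed (auto simp: r_def)
    ultimately show "s \<in> ?F ` {r. correspondence r A B}" by blast
  next
    fix s assume "s \<in> ?F ` {r. correspondence r A B}"
    then obtain r where r: "correspondence r A B" and s: "s = ?F r" by auto
    have hr: "(h x, h y) \<in> s" if "(x, y) \<in> r" for x y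
      using that s by force
    have "s \<subseteq> h ` A \<times> h ` B"
      using r s unfolding correspondence_def by auto
    moreover have "\<forall>u\<in>h ` A. \<exists>v\<in>h ` B. (u, v) \<in> s" "\<forall>v\<in>h ` B. \<exists>u\<in>h ` A. (u, v) \<in> s"
      using r hr unfolding correspondence_def by blast+
    ultimately show "s \<in> {r. correspondence r (h ` A) (h ` B)}"
      unfolding correspondence_def by blast
  qed
  show ?thesis
    unfolding hausdorff_dist_def corr
    by (rule arg_cong[where f = Inf], subst image_image, rule image_cong[OF refl], rule sup)
      (simp only: mem_Collect_eq)
qed

lemma ambient_in_sum_type:
  fixes X :: "'a metric" and Y :: "'b metric" and Z :: "'c metric"
  assumes f: "isometric_embedding X Z f" and g: "isometric_embedding Y Z g"
  shows "\<exists>(Z' :: ('a + 'b) metric) f' g'.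
           isometric_embedding X Z' f' \<and> isometric_embedding Y Z' g' \<and>
           hausdorff_dist (mdist Z') (f' ` mspace X) (g' ` mspace Y) =
           hausdorff_dist (mdist Z) (f ` mspace X) (g ` mspace Y)"
proof -
  define C where "C = f ` mspace X \<union> g ` mspace Y"
  define h :: "'c \<Rightarrow> 'a + 'b" where
    "h z = (if z \<in> f ` mspace X then Inl (inv_into (mspace X) f z)
            else Inr (inv_into (mspace Y) g z))" for z
  have inj: "inj_on h C"
  proof (rule inj_onI)
    fix u v assume "u \<in> C" "v \<in> C" "h u = h v"
    then show "u = v"
      unfolding h_def C_def
      by (auto split: if_splits dest: inv_into_injective)
  qed
  define k where "k = inv_into C h"
  have kh: "k (h z) = z" if "z \<in> C" for z
    using inj that by (simp add: k_def)
  have CZ: "C \<subseteq> mspace Z"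
    using f g by (auto simp: C_def isometric_embedding_def)
  have M: "Metric_space (h ` C) (\<lambda>u v. mdist Z (k u) (k v))"
  proof
    fix u v w assume "u \<in> h ` C" "v \<in> h ` C" "w \<in> h ` C"
    then have "k u \<in> mspace Z" "k v \<in> mspace Z" "k w \<in> mspace Z"
      using CZ kh by auto
    then show "mdist Z (k u) (k w) \<le> mdist Z (k u) (k v) + mdist Z (k v) (k w)"
      by (rule mdist_triangle)
  next
    fix u v assume uv: "u \<in> h ` C" "v \<in> h ` C"
    then have "k u \<in> mspace Z" "k v \<in> mspace Z" "h (k u) = u" "h (k v) = v"
      using CZ kh by auto
    then show "mdist Z (k u) (k v) = 0 \<longleftrightarrow> u = v"
      by (metis mdist_zero)
  qed (simp_all add: mdist_commute)
  define Z' where "Z' = metric (h ` C, \<lambda>u v. mdist Z (k u) (k v))"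
  have Z': "mspace Z' = h ` C" "mdist Z' = (\<lambda>u v. mdist Z (k u) (k v))"
    using M by (simp_all add: Z'_def Metric_space.mspace_metric Metric_space.mdist_metric)
  have "isometric_embedding X Z' (h \<circ> f)" "isometric_embedding Y Z' (h \<circ> g)"
    using f g kh by (auto simp: isometric_embedding_def Z' C_def)
  moreover have "hausdorff_dist (mdist Z') (h ` f ` mspace X) (h ` g ` mspace Y) =
      hausdorff_dist (mdist Z) (f ` mspace X) (g ` mspace Y)"
    by (rule hausdorff_dist_image) (use inj kh in \<open>auto simp: C_def Z'\<close>)
  ultimately show ?thesis
    unfolding image_comp by blast
qed


section \<open>Isometry classes of finite metric spaces\<close>

definition isometric :: "'a metric \<Rightarrow> 'b metric \<Rightarrow> bool" where
  "isometric X Y \<longleftrightarrow> (\<exists>f. isometric_embedding X Y f \<and> f ` mspace X = mspace Y)"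

definition mdiameter :: "'a metric \<Rightarrow> real" where
  "mdiameter X = (SUP (x, y)\<in>mspace X \<times> mspace X. mdist X x y)"

text \<open>Points of finite metric spaces are taken to be natural numbers; by the lemma
  \<open>isometric_nat_metric\<close> below, every finite metric space is isometric to one of these.\<close>

definition finite_metrics :: "real \<Rightarrow> nat metric set" where
  "finite_metrics R = {X. mspace X \<noteq> {} \<and> finite (mspace X) \<and> mdiameter X \<le> R}"

definition isometry_rel :: "real \<Rightarrow> (nat metric \<times> nat metric) set" where
  "isometry_rel R = {(X, Y). X \<in> finite_metrics R \<and> Y \<in> finite_metrics R \<and> isometric X Y}"

definition GH_space :: "real \<Rightarrow> nat metric set set" where
  "GH_space R = finite_metrics R // isometry_rel R"

text \<open>Independence of the chosen representatives is the lemma \<open>GH_class_dist_eq\<close> below.\<close>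

definition GH_class_dist :: "nat metric set \<Rightarrow> nat metric set \<Rightarrow> real" where
  "GH_class_dist C D = GH_dist (SOME X. X \<in> C) (SOME Y. Y \<in> D)"

lemma mdiameter_le_iff:
  assumes "finite (mspace X)" "mspace X \<noteq> {}"
  shows "mdiameter X \<le> R \<longleftrightarrow> (\<forall>x\<in>mspace X. \<forall>y\<in>mspace X. mdist X x y \<le> R)"
proof -
  have "finite ((\<lambda>(x, y). mdist X x y) ` (mspace X \<times> mspace X))"
    using assms by simp
  then show ?thesis
    unfolding mdiameter_def
    by (subst cSup_le_iff) (use assms bdd_above_finite in auto)
qed

lemma isometric_nat_metric:
  fixes X :: "'a metric"
  assumes "finite (mspace X)"
  shows "\<exists>Y :: nat metric. isometric X Y"
proof -
  obtain h :: "'a \<Rightarrow> nat" where inj: "inj_on h (mspace X)"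
    using finite_imp_inj_to_nat_seg[OF assms] by blast
  define k where "k = inv_into (mspace X) h"
  have kh: "k (h z) = z" if "z \<in> mspace X" for z
    using inj that by (simp add: k_def)
  have M: "Metric_space (h ` mspace X) (\<lambda>u v. mdist X (k u) (k v))"
  proof
    fix u v w assume "u \<in> h ` mspace X" "v \<in> h ` mspace X" "w \<in> h ` mspace X"
    then have "k u \<in> mspace X" "k v \<in> mspace X" "k w \<in> mspace X"
      using kh by auto
    then show "mdist X (k u) (k w) \<le> mdist X (k u) (k v) + mdist X (k v) (k w)"
      by (rule mdist_triangle)
  next
    fix u v assume uv: "u \<in> h ` mspace X" "v \<in> h ` mspace X"
    then have "k u \<in> mspace X" "k v \<in> mspace X" "h (k u) = u" "h (k v) = v"
      using kh by auto
    then show "mdist X (k u) (k v) = 0 \<longleftrightarrow> u = v"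
      by (metis mdist_zero)
  qed (simp_all add: mdist_commute)
  define Y where "Y = metric (h ` mspace X, \<lambda>u v. mdist X (k u) (k v))"
  have Y: "mspace Y = h ` mspace X" "mdist Y = (\<lambda>u v. mdist X (k u) (k v))"
    using M by (simp_all add: Y_def Metric_space.mspace_metric Metric_space.mdist_metric)
  have "isometric_embedding X Y h" "h ` mspace X = mspace Y"
    using kh by (auto simp: isometric_embedding_def Y)
  then show ?thesis
    unfolding isometric_def by blast
qed

lemma isometric_refl: "isometric X X"
  unfolding isometric_def isometric_embedding_def by (rule exI[of _ id]) auto

lemma isometric_trans:
  assumes "isometric X Y" "isometric Y Z"
  shows "isometric X Z"
proof -
  obtain f g where "isometric_embedding X Y f" "f ` mspace X = mspace Y"
    "isometric_embedding Y Z g" "g ` mspace Y = mspace Z"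
    using assms unfolding isometric_def by blast
  then have "isometric_embedding X Z (g \<circ> f)" "(g \<circ> f) ` mspace X = mspace Z"
    unfolding isometric_embedding_def image_comp[symmetric] by (simp_all add: Pi_iff)
  then show ?thesis
    unfolding isometric_def by blast
qed

lemma isometric_sym:
  assumes "isometric X Y"
  shows "isometric Y X"
proof -
  obtain f where f: "isometric_embedding X Y f" and im: "f ` mspace X = mspace Y"
    using assms unfolding isometric_def by blast
  have inj: "inj_on f (mspace X)"
  proof (rule inj_onI)
    fix x y assume xy: "x \<in> mspace X" "y \<in> mspace X" "f x = f y"
    then have "mdist Y (f x) (f y) = 0"
      using im by (metis imageI mdist_zero)
    moreover have "mdist Y (f x) (f y) = mdist X x y"
      using f xy(1,2) unfolding isometric_embedding_def by blast
    ultimately have "mdist X x y = 0" by simp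
    then show "x = y"
      using xy by simp
  qed
  have "isometric_embedding Y X (inv_into (mspace X) f)"
    using f inj unfolding isometric_embedding_def im[symmetric] by auto
  moreover have "inv_into (mspace X) f ` mspace Y = mspace X"
    using inj im by (simp flip: im add: inv_into_image_cancel)
  ultimately show ?thesis
    unfolding isometric_def by blast
qed

lemma equiv_isometry_rel: "equiv (finite_metrics R) (isometry_rel R)"
  by (rule equivI)
    (auto simp: isometry_rel_def refl_on_def sym_def trans_def
      intro: isometric_refl isometric_sym isometric_trans)

lemma GH_dist_isometric:
  fixes X X' :: "'a metric" and Y Y' :: "'b metric"
  assumes "isometric X X'" "isometric Y Y'"
  shows "GH_dist X Y = GH_dist X' Y'"
proof -
  let ?V = "\<lambda>(X :: 'a metric) (Y :: 'b metric).
    {hausdorff_dist (mdist Z) (f ` mspace X) (g ` mspace Y) |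
     (Z :: ('a + 'b) metric) f g. isometric_embedding X Z f \<and> isometric_embedding Y Z g}"
  have sub: "?V X' Y' \<subseteq> ?V X Y" if iso: "isometric X X'" "isometric Y Y'"
    for X X' :: "'a metric" and Y Y' :: "'b metric"
  proof
    fix t assume "t \<in> ?V X' Y'"
    then obtain Z :: "('a + 'b) metric" and f g
      where t: "t = hausdorff_dist (mdist Z) (f ` mspace X') (g ` mspace Y')"
        and fg: "isometric_embedding X' Z f" "isometric_embedding Y' Z g"
      by blast
    obtain p q where pq: "isometric_embedding X X' p" "p ` mspace X = mspace X'"
      "isometric_embedding Y Y' q" "q ` mspace Y = mspace Y'"
      using iso unfolding isometric_def by blast
    have "isometric_embedding X Z (f \<circ> p)" "isometric_embedding Y Z (g \<circ> q)"
      using fg pq by (auto simp: isometric_embedding_def Pi_iff)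
    moreover have "t = hausdorff_dist (mdist Z) ((f \<circ> p) ` mspace X) ((g \<circ> q) ` mspace Y)"
      unfolding t image_comp[symmetric] pq ..
    ultimately show "t \<in> ?V X Y" by blast
  qed
  have "?V X Y = ?V X' Y'"
    using sub assms by (intro equalityI) (blast intro: isometric_sym)+
  then show ?thesis
    unfolding GH_dist_def by simp
qed

lemma GH_class_dist_eq:
  assumes "C \<in> GH_space R" "D \<in> GH_space R" "X \<in> C" "Y \<in> D"
  shows "GH_class_dist C D = GH_dist X Y"
proof -
  have iso: "isometric U (SOME X. X \<in> E)" if "E \<in> GH_space R" "U \<in> E" for E U
  proof -
    have "(SOME X. X \<in> E) \<in> E"
      using that by (metis someI)
    then have "(U, SOME X. X \<in> E) \<in> isometry_rel R"
      using that equiv_isometry_rel quotient_eq_iff unfolding GH_space_def by metis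
    then show ?thesis
      by (simp add: isometry_rel_def)
  qed
  show ?thesis
    unfolding GH_class_dist_def
    by (rule GH_dist_isometric[symmetric]) (use iso assms in auto)
qed


section \<open>Bi-Lipschitz embeddings\<close>

definition bi_lipschitz_embedding ::
    "'a set \<Rightarrow> ('a \<Rightarrow> 'a \<Rightarrow> real) \<Rightarrow> 'b set \<Rightarrow> ('b \<Rightarrow> 'b \<Rightarrow> real) \<Rightarrow> ('a \<Rightarrow> 'b) \<Rightarrow> bool" where
  "bi_lipschitz_embedding M d M' d' \<psi> \<longleftrightarrow> \<psi> \<in> M \<rightarrow> M' \<and>
     (\<exists>a>0. \<exists>b>0. \<forall>x\<in>M. \<forall>y\<in>M. a * d x y \<le> d' (\<psi> x) (\<psi> y) \<and> d' (\<psi> x) (\<psi> y) \<le> b * d x y)"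

end

theory Submission
  imports Defs
begin

text \<open>
  A finite-dimensional space contains only boundedly many points whose mutual
  distances lie between \<open>t\<close> and \<open>L * t\<close>, with a bound independent of the scale \<open>t\<close>, and this
  property is inherited by bi-Lipschitz preimages. It fails in the Gromov-Hausdorff space: for
  small \<open>u\<close> the subsets \<open>A\<^sub>k = u * ({0} \<union> {8 i + 4 + of_bool (i = k) | i < m})\<close> of the line have
  mutual Hausdorff distance at most \<open>u\<close>. On the other hand the distance set of a space varies by
  at most twice the Gromov-Hausdorff distance; all distances in question are integer multiples of
  \<open>u\<close>, and \<open>u * (8 k + 5)\<close> is a distance in \<open>A\<^sub>k\<close> only, so the mutual Gromov-Hausdorff distances
  are at least \<open>u / 2\<close>.
\<close>

section \<open>Separated families in finite-dimensional spaces\<close>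

text \<open>The difference of \<open>x\<close> and its orthogonal expansion \<open>y\<close> lies in
  the span of \<open>C\<close> and is orthogonal to \<open>C\<close>, hence to itself, so it
  vanishes; the triangle inequality does the rest. A zero vector in \<open>C\<close> is harmless, as
  division by zero gives 0.\<close>

lemma norm_le_sum_orthogonal_coordinates:
  fixes x :: "'h::real_inner"
  assumes "finite C" "pairwise orthogonal C" "x \<in> span C"
  shows "norm x \<le> (\<Sum>c\<in>C. \<bar>x \<bullet> c\<bar> / norm c)"
proof -
  define y where "y = (\<Sum>c\<in>C. (x \<bullet> c / (c \<bullet> c)) *\<^sub>R c)"
  have "orthogonal (x - y) c" if "c \<in> C" for c
  proof -
    have "y \<bullet> c = (\<Sum>c'\<in>C. if c' = c then x \<bullet> c else 0)"
      unfolding y_def inner_sum_left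
      by (rule sum.cong[OF refl])
        (use assms(2) that in \<open>auto simp: pairwise_def orthogonal_def\<close>)
    also have "\<dots> = x \<bullet> c"
      using assms(1) that by simp
    finally show ?thesis
      by (simp add: orthogonal_def inner_diff_left)
  qed
  moreover have "x - y \<in> span C"
    unfolding y_def by (intro span_diff assms(3) span_sum span_scale span_base)
  ultimately have "orthogonal (x - y) (x - y)"
    by (metis orthogonal_to_span)
  then have "x = y"
    by (simp add: orthogonal_self)
  then have "norm x \<le> (\<Sum>c\<in>C. norm ((x \<bullet> c / (c \<bullet> c)) *\<^sub>R c))"
    unfolding y_def by (metis norm_sum)
  also have "\<dots> = (\<Sum>c\<in>C. \<bar>x \<bullet> c\<bar> / norm c)"
    by (rule sum.cong[OF refl]) (simp add: power2_norm_eq_inner[symmetric] power2_eq_square)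
  finally show ?thesis .
qed

text \<open>Pigeonhole on a grid of mesh \<open>t / q\<close>: the number of cells available depends
  on \<open>L\<close> and the space but not on \<open>t\<close> or \<open>f\<close>, and two points
  in one cell are closer than \<open>t\<close>.\<close>

lemma finite_dim_separated_family_bound:
  fixes B :: "'h::real_inner set" and L :: real
  assumes "finite B" "span B = (UNIV :: 'h set)"
  shows "\<exists>m. \<forall>t>0. \<forall>f :: nat \<Rightarrow> 'h. \<exists>i<m. \<exists>j<m. i \<noteq> j \<and>
           (dist (f i) (f j) < t \<or> L * t < dist (f i) (f j))"
proof -
  obtain C where C: "finite C" "span C = (UNIV :: 'h set)" "pairwise orthogonal C"
    using basis_orthogonal[OF assms(1)] assms(2) by metis
  \<comment> \<open>Chosen larger than the number of coordinates: points that differ by at most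
    \<open>t / q\<close> in each one are at distance at most
    \<open>card C * (t / q) < t\<close>.\<close>
  define q where "q = real (card C) + 1"
  have q: "q > 0"
    by (simp add: q_def)
  \<comment> \<open>The possible cell labels. \<open>max L 0\<close> covers negative
    \<open>L\<close>, since the base point \<open>f 0\<close> has coordinates 0 whatever
    \<open>L\<close> is.\<close>
  define P where "P = PiE C (\<lambda>_. {\<lfloor>- (q * max L 0)\<rfloor>..\<lfloor>q * max L 0\<rfloor>})"
  have "finite P"
    unfolding P_def using C(1) by (intro finite_PiE) auto
  have "\<exists>i<Suc (card P). \<exists>j<Suc (card P). i \<noteq> j \<and>
           (dist (f i) (f j) < t \<or> L * t < dist (f i) (f j))"
    if t: "t > 0" for t and f :: "nat \<Rightarrow> 'h"
  proof (rule ccontr)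
    let ?I = "{..<Suc (card P)}"
    assume "\<not> ?thesis"
    then have "\<forall>i\<in>?I. \<forall>j\<in>?I. i \<noteq> j \<longrightarrow> t \<le> dist (f i) (f j) \<and> dist (f i) (f j) \<le> L * t"
      by (meson lessThan_iff linorder_not_less)
    then have sep: "t \<le> dist (f i) (f j)" and bnd: "dist (f i) (f j) \<le> L * t"
      if "i \<in> ?I" "j \<in> ?I" "i \<noteq> j" for i j
      using that by blast+
    \<comment> \<open>Coordinates in units of \<open>t / q\<close>, taken relative to
      \<open>f 0\<close> because only mutual distances are bounded.\<close>
    define a where "a i c = q * ((f i - f 0) \<bullet> c / norm c) / t" for i c
    define g where "g i = (\<lambda>c\<in>C. \<lfloor>a i c\<rfloor>)" for i
    have "g ` ?I \<subseteq> P"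
    proof
      fix h assume "h \<in> g ` ?I"
      then obtain i where i: "i \<in> ?I" and h: "h = g i" by blast
      have "\<bar>a i c\<bar> \<le> q * max L 0" for c
      proof -
        have "norm (f i - f 0) \<le> max L 0 * t"
        proof (cases "i = 0")
          case False
          then have "norm (f i - f 0) \<le> L * t"
            using bnd[of i 0] i by (simp add: dist_norm)
          also have "\<dots> \<le> max L 0 * t"
            using t by (intro mult_right_mono) auto
          finally show ?thesis .
        qed (use t in simp)
        moreover have "\<bar>(f i - f 0) \<bullet> c\<bar> / norm c \<le> norm (f i - f 0)"
          using Cauchy_Schwarz_ineq2[of "f i - f 0" c]
          by (cases "c = 0") (auto simp: field_simps)
        ultimately have "\<bar>(f i - f 0) \<bullet> c / norm c\<bar> \<le> max L 0 * t"
          by (simp add: abs_divide)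
        then have "q * \<bar>(f i - f 0) \<bullet> c / norm c\<bar> \<le> q * (max L 0 * t)"
          using q by (intro mult_left_mono) auto
        moreover have "\<bar>a i c\<bar> = q * \<bar>(f i - f 0) \<bullet> c / norm c\<bar> / t"
          using q t by (simp add: a_def abs_mult)
        ultimately show ?thesis
          using t by (simp only: pos_divide_le_eq mult.assoc)
      qed
      then have "- (q * max L 0) \<le> a i c" "a i c \<le> q * max L 0" for c
        by (simp_all add: abs_le_iff minus_le_iff)
      then show "h \<in> P"
        unfolding P_def h g_def by (auto intro!: floor_mono)
    qed
    then have "card (g ` ?I) \<le> card P"
      using \<open>finite P\<close> by (rule card_mono[rotated])
    then have "\<not> inj_on g ?I"
      by (intro pigeonhole) simp
    then obtain i j where ij: "i \<in> ?I" "j \<in> ?I" "i \<noteq> j" "g i = g j"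
      by (auto simp: inj_on_def)
    have "\<bar>(f i - f j) \<bullet> c\<bar> / norm c \<le> t / q" if "c \<in> C" for c
    proof -
      have "\<lfloor>a i c\<rfloor> = \<lfloor>a j c\<rfloor>"
        using fun_cong[OF ij(4), of c] that by (simp add: g_def)
      then have "\<bar>a i c - a j c\<bar> \<le> 1"
        by linarith
      moreover have "a i c - a j c = q * ((f i - f j) \<bullet> c / norm c) / t"
        unfolding a_def
        by (simp add: inner_diff_left diff_divide_distrib right_diff_distrib)
      ultimately have "q * (\<bar>(f i - f j) \<bullet> c\<bar> / norm c) / t \<le> 1"
        using q t by (simp add: abs_mult abs_divide)
      then show ?thesis
        using q t
        by (simp only: pos_divide_le_eq pos_le_divide_eq mult_1_left mult.commute[of q])
    qed
    then have "(\<Sum>c\<in>C. \<bar>(f i - f j) \<bullet> c\<bar> / norm c) \<le> real (card C) * (t / q)"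
      by (rule sum_bounded_above)
    moreover have "norm (f i - f j) \<le> (\<Sum>c\<in>C. \<bar>(f i - f j) \<bullet> c\<bar> / norm c)"
      using C by (intro norm_le_sum_orthogonal_coordinates) auto
    ultimately have "dist (f i) (f j) \<le> real (card C) * (t / q)"
      by (simp add: dist_norm)
    also have "\<dots> < t"
      using q t by (simp add: q_def field_simps)
    finally show False
      using sep[of i j] ij by simp
  qed
  then show ?thesis by blast
qed

section \<open>Bounds for the Gromov-Hausdorff distance\<close>

text \<open>A correspondence of finite nonempty sets is finite and nonempty, so the supremum is an
  attained maximum.\<close>

lemma correspondence_SUP:
  fixes d :: "'a \<Rightarrow> 'a \<Rightarrow> real"
  assumes "correspondence r A B" "finite A" "finite B" "A \<noteq> {}"
  shows "\<exists>x y. (x, y) \<in> r \<and> (SUP (x, y)\<in>r. d x y) = d x y"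
    and "\<And>x y. (x, y) \<in> r \<Longrightarrow> d x y \<le> (SUP (x, y)\<in>r. d x y)"
proof -
  have fin: "finite r"
    using assms finite_subset[of r "A \<times> B"] by (simp add: correspondence_def)
  have ne: "r \<noteq> {}"
    using assms by (auto simp: correspondence_def)
  have "(SUP (x, y)\<in>r. d x y) \<in> (\<lambda>(x, y). d x y) ` r"
    using fin ne by (subst cSup_eq_Max) (auto simp del: image_iff intro!: Max_in)
  then show "\<exists>x y. (x, y) \<in> r \<and> (SUP (x, y)\<in>r. d x y) = d x y"
  proof (rule imageE)
    fix p assume "(SUP (x, y)\<in>r. d x y) = (case p of (x, y) \<Rightarrow> d x y)" "p \<in> r"
    then show ?thesis by (cases p) auto
  qed
  show "d x y \<le> (SUP (x, y)\<in>r. d x y)" if "(x, y) \<in> r" for x y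
    using cSUP_upper[OF that, of "\<lambda>(x, y). d x y"] fin by (simp add: bdd_above_finite)
qed

lemma hausdorff_dist_le:
  assumes "correspondence r A B" "finite A" "finite B" "A \<noteq> {}"
    and "\<And>x y. (x, y) \<in> r \<Longrightarrow> d x y \<le> c" "\<And>x y. 0 \<le> d x y"
  shows "hausdorff_dist d A B \<le> c"
proof -
  have nonneg: "0 \<le> (SUP (x, y)\<in>s. d x y)" if "correspondence s A B" for s
    using correspondence_SUP(1)[OF that assms(2-4), of d] assms(6) by fastforce
  \<comment> \<open>Nonnegativity of \<open>d\<close> bounds the infimum from below, so a single
    correspondence gives an upper bound.\<close>
  have "hausdorff_dist d A B \<le> (SUP (x, y)\<in>r. d x y)"
    unfolding hausdorff_dist_def
    by (rule cINF_lower) (use nonneg assms(1) in \<open>auto intro!: bdd_belowI2[where m = 0]\<close>)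
  also have "\<dots> \<le> c"
    using correspondence_SUP(1)[OF assms(1-4), of d] assms(5) by fastforce
  finally show ?thesis .
qed

lemma hausdorff_dist_ge:
  assumes "finite A" "finite B" "A \<noteq> {}" "B \<noteq> {}"
    and "\<And>r. correspondence r A B \<Longrightarrow> \<exists>(x, y)\<in>r. c \<le> d x y"
  shows "c \<le> hausdorff_dist d A B"
  unfolding hausdorff_dist_def
proof (rule cINF_greatest)
  have "correspondence (A \<times> B) A B"
    using assms(3,4) by (auto simp: correspondence_def)
  then show "{r. correspondence r A B} \<noteq> {}" by blast
  fix r assume "r \<in> {r. correspondence r A B}"
  then have r: "correspondence r A B" by simp
  then obtain x y where "(x, y) \<in> r" "c \<le> d x y"
    using assms(5) by blast
  then show "c \<le> (SUP (x, y)\<in>r. d x y)"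
    using correspondence_SUP(2)[OF r assms(1-3), of x y d] by linarith
qed

lemma hausdorff_dist_nonneg:
  assumes "finite A" "finite B" "A \<noteq> {}" "B \<noteq> {}" "\<And>x y. 0 \<le> d x y"
  shows "0 \<le> hausdorff_dist d A B"
proof (rule hausdorff_dist_ge[OF assms(1-4)])
  fix r assume "correspondence r A B"
  then show "\<exists>(x, y)\<in>r. 0 \<le> d x y"
    using assms(3,5) unfolding correspondence_def by fast
qed

text \<open>Allows an ambient space of any type: \<open>ambient_in_sum_type\<close> moves it into
  the sum type, and 0 bounds all competing values from below.\<close>

lemma GH_dist_le_hausdorff_dist:
  fixes X :: "'a metric" and Y :: "'b metric" and Z :: "'c metric"
  assumes "finite (mspace X)" "mspace X \<noteq> {}" "finite (mspace Y)" "mspace Y \<noteq> {}"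
    and "isometric_embedding X Z f" "isometric_embedding Y Z g"
  shows "GH_dist X Y \<le> hausdorff_dist (mdist Z) (f ` mspace X) (g ` mspace Y)"
proof -
  obtain Z' :: "('a + 'b) metric" and f' g'
    where Z': "isometric_embedding X Z' f'" "isometric_embedding Y Z' g'"
      "hausdorff_dist (mdist Z') (f' ` mspace X) (g' ` mspace Y) =
       hausdorff_dist (mdist Z) (f ` mspace X) (g ` mspace Y)"
    using ambient_in_sum_type[OF assms(5,6)] by blast
  show ?thesis
    unfolding GH_dist_def
  proof (rule cInf_lower)
    show "bdd_below {hausdorff_dist (mdist Z) (f ` mspace X) (g ` mspace Y) |
      (Z :: ('a + 'b) metric) f g. isometric_embedding X Z f \<and> isometric_embedding Y Z g}"
      by (rule bdd_belowI[where m = 0]) (use assms in \<open>auto intro!: hausdorff_dist_nonneg\<close>)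
  qed (use Z' in force)
qed

text \<open>In any ambient space a correspondence gives \<open>x\<close> and \<open>x'\<close>
  partners \<open>y\<close> and \<open>y'\<close>. The two distances differ by at most the sum of
  the displacements, so one displacement is at least \<open>c\<close>. The given embeddings show
  that the infimum is over a nonempty set.\<close>

lemma GH_dist_ge:
  fixes X :: "'a metric" and Y :: "'b metric" and Z :: "'c metric"
  assumes fin: "finite (mspace X)" "mspace X \<noteq> {}" "finite (mspace Y)" "mspace Y \<noteq> {}"
    and emb: "isometric_embedding X Z f" "isometric_embedding Y Z g"
    and x: "x \<in> mspace X" "x' \<in> mspace X"
    and gap: "\<And>y y'. y \<in> mspace Y \<Longrightarrow> y' \<in> mspace Y \<Longrightarrow> 2 * c \<le> \<bar>mdist X x x' - mdist Y y y'\<bar>"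
  shows "c \<le> GH_dist X Y"
  unfolding GH_dist_def
proof (rule cInf_greatest)
  show "{hausdorff_dist (mdist Z) (f ` mspace X) (g ` mspace Y) |
      (Z :: ('a + 'b) metric) f g. isometric_embedding X Z f \<and> isometric_embedding Y Z g} \<noteq> {}"
    using ambient_in_sum_type[OF emb] by blast
  fix v assume "v \<in> {hausdorff_dist (mdist Z) (f ` mspace X) (g ` mspace Y) |
      (Z :: ('a + 'b) metric) f g. isometric_embedding X Z f \<and> isometric_embedding Y Z g}"
  then obtain Z :: "('a + 'b) metric" and f g
    where v: "v = hausdorff_dist (mdist Z) (f ` mspace X) (g ` mspace Y)"
      and f: "isometric_embedding X Z f" and g: "isometric_embedding Y Z g"
    by blast
  show "c \<le> v"
    unfolding v
  proof (rule hausdorff_dist_ge)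
    fix r assume r: "correspondence r (f ` mspace X) (g ` mspace Y)"
    then obtain y y' where y: "y \<in> mspace Y" "y' \<in> mspace Y" "(f x, g y) \<in> r" "(f x', g y') \<in> r"
      using x unfolding correspondence_def by blast
    have Z: "f x \<in> mspace Z" "f x' \<in> mspace Z" "g y \<in> mspace Z" "g y' \<in> mspace Z"
      using f g x y by (auto simp: isometric_embedding_def)
    have eq: "mdist X x x' = mdist Z (f x) (f x')" "mdist Y y y' = mdist Z (g y) (g y')"
      using f g x y by (auto simp: isometric_embedding_def)
    have "\<bar>mdist X x x' - mdist Y y y'\<bar> \<le> mdist Z (f x) (g y) + mdist Z (f x') (g y')"
      unfolding eq
      using mdist_triangle[OF Z(1,3,2)] mdist_triangle[OF Z(3,4,2)]
        mdist_triangle[OF Z(3,1,4)] mdist_triangle[OF Z(1,2,4)]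
        mdist_commute[of Z "f x" "g y"] mdist_commute[of Z "f x'" "g y'"]
      by linarith
    then have "c \<le> mdist Z (f x) (g y) \<or> c \<le> mdist Z (f x') (g y')"
      using gap[OF y(1,2)] by linarith
    then show "\<exists>(x, y)\<in>r. c \<le> mdist Z x y"
      using y by blast
  qed (use fin in auto)
qed

section \<open>Separated families in the Gromov-Hausdorff space\<close>

text \<open>One ambient space for all combs, which then embed by \<open>id\<close>.\<close>

definition scaled_nat_metric :: "real \<Rightarrow> nat metric" where
  "scaled_nat_metric u = metric (UNIV, \<lambda>x y. u * \<bar>real x - real y\<bar>)"

lemma scaled_nat_metric:
  assumes "u > 0"
  shows "mspace (scaled_nat_metric u) = UNIV"
    and "mdist (scaled_nat_metric u) = (\<lambda>x y. u * \<bar>real x - real y\<bar>)"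
proof -
  have "Metric_space UNIV (\<lambda>x y :: nat. u * \<bar>real x - real y\<bar>)"
    by unfold_locales
      (use assms in \<open>auto simp: abs_minus_commute simp flip: distrib_left intro!: mult_left_mono\<close>)
  then show "mspace (scaled_nat_metric u) = UNIV"
    "mdist (scaled_nat_metric u) = (\<lambda>x y. u * \<bar>real x - real y\<bar>)"
    by (simp_all add: scaled_nat_metric_def Metric_space.mspace_metric Metric_space.mdist_metric)
qed

lemma isometric_embedding_submetric:
  "A \<subseteq> mspace Z \<Longrightarrow> isometric_embedding (submetric Z A) Z id"
  by (auto simp: isometric_embedding_def)

definition comb_pt :: "nat \<Rightarrow> nat \<Rightarrow> nat" where
  "comb_pt k i = 8 * i + 4 + of_bool (i = k)"

definition comb :: "nat \<Rightarrow> nat \<Rightarrow> nat set" where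
  "comb m k = insert 0 (comb_pt k ` {..<m})"

text \<open>Modulo 8 the points are 0, 4 or 5, the residue 5 occurring only at the shifted tooth
  \<open>8 * l + 5\<close>. Distances between teeth are 0, 1 or 7 modulo 8, and those from 0 to
  unshifted teeth are 4, so a distance congruent to 5 can only be \<open>8 * l + 5\<close>.\<close>

lemma comb_distance_unique:
  assumes "k \<noteq> l" "y \<in> comb m l" "y' \<in> comb m l"
  shows "\<bar>int y - int y'\<bar> \<noteq> 8 * int k + 5"
proof -
  have form: "z = 0 \<or> (\<exists>i. z = 8 * i + 4) \<or> z = 8 * l + 5" if "z \<in> comb m l" for z
    using that by (auto simp: comb_def comb_pt_def of_bool_def)
  have "z \<noteq> z' + (8 * k + 5)" if "z \<in> comb m l" "z' \<in> comb m l" for z z'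
    using form[OF that(1)] form[OF that(2)] assms(1) by (elim disjE exE; simp) presburger+
  then have "y \<noteq> y' + (8 * k + 5)" "y' \<noteq> y + (8 * k + 5)"
    using assms by blast+
  then show ?thesis by linarith
qed

text \<open>Match 0 with 0 and teeth of equal index; each tooth moves by at most one unit.\<close>

lemma hausdorff_dist_comb_le:
  assumes "u > 0"
  shows "hausdorff_dist (mdist (scaled_nat_metric u)) (comb m k) (comb m l) \<le> u"
proof (rule hausdorff_dist_le)
  let ?r = "insert (0, 0) ((\<lambda>i. (comb_pt k i, comb_pt l i)) ` {..<m})"
  show "correspondence ?r (comb m k) (comb m l)"
    unfolding correspondence_def comb_def by blast
  show "mdist (scaled_nat_metric u) x y \<le> u" if "(x, y) \<in> ?r" for x y
    using that assms by (auto simp: scaled_nat_metric comb_pt_def of_bool_def split: if_splits)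
qed (auto simp: comb_def)

theorem theorem3:
  fixes R :: real and B :: "'h::{real_inner, complete_space} set"
  assumes "R > 0"
    and "finite B" and "span B = (UNIV :: 'h set)"
  shows "\<not> (\<exists>\<psi> :: nat metric set \<Rightarrow> 'h.
           bi_lipschitz_embedding (GH_space R) GH_class_dist UNIV dist \<psi>)"
proof
  assume "\<exists>\<psi> :: nat metric set \<Rightarrow> 'h.
    bi_lipschitz_embedding (GH_space R) GH_class_dist UNIV dist \<psi>"
  then obtain \<psi> :: "nat metric set \<Rightarrow> 'h" and a b where ab: "a > 0" "b > 0"
    and lip: "\<And>C D. C \<in> GH_space R \<Longrightarrow> D \<in> GH_space R \<Longrightarrow>
      a * GH_class_dist C D \<le> dist (\<psi> C) (\<psi> D) \<and> dist (\<psi> C) (\<psi> D) \<le> b * GH_class_dist C D"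
    unfolding bi_lipschitz_embedding_def by blast
  \<comment> \<open>Distances between \<open>u / 2\<close> and \<open>u\<close> become distances
    between \<open>a * u / 2\<close> and \<open>b * u\<close>, whose ratio is
    \<open>2 * b / a\<close>. As \<open>m\<close> does not depend on the scale, \<open>u\<close> may
    be chosen after it.\<close>
  obtain m where m: "\<forall>t>0. \<forall>f :: nat \<Rightarrow> 'h. \<exists>i<m. \<exists>j<m. i \<noteq> j \<and>
      (dist (f i) (f j) < t \<or> 2 * b / a * t < dist (f i) (f j))"
    using finite_dim_separated_family_bound[OF assms(2,3), of "2 * b / a"] by blast
  have "m > 0"
    using m[rule_format, of 1 "\<lambda>_. 0"] by auto
  \<comment> \<open>The points of a comb are at most \<open>8 * m\<close>, so this scale makes the
    diameter at most \<open>R\<close>.\<close>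
  define u where "u = R / (8 * real m)"
  have u: "u > 0"
    using \<open>m > 0\<close> \<open>R > 0\<close> by (simp add: u_def)
  define X where "X k = submetric (scaled_nat_metric u) (comb m k)" for k
  have X: "mspace (X k) = comb m k" "mdist (X k) = (\<lambda>x y. u * \<bar>real x - real y\<bar>)" for k
    using u by (simp_all add: X_def scaled_nat_metric)
  have fin: "finite (mspace (X k))" "mspace (X k) \<noteq> {}" for k
    by (simp_all add: X comb_def)
  have emb: "isometric_embedding (X k) (scaled_nat_metric u) id" for k
    unfolding X_def by (rule isometric_embedding_submetric) (simp add: scaled_nat_metric u)
  have finX: "X k \<in> finite_metrics R" for k
  proof -
    have le: "x \<le> 8 * m" if "x \<in> comb m k" for x
      using that by (auto simp: comb_def comb_pt_def of_bool_def)
    have "\<bar>real x - real y\<bar> \<le> 8 * real m" if "x \<in> comb m k" "y \<in> comb m k" for x y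
      using le[OF that(1)] le[OF that(2)] by linarith
    then have "u * \<bar>real x - real y\<bar> \<le> u * (8 * real m)" if "x \<in> comb m k" "y \<in> comb m k" for x y
      using that u by simp
    moreover have "u * (8 * real m) = R"
      using \<open>m > 0\<close> by (simp add: u_def)
    ultimately show ?thesis
      using fin[of k] by (simp add: finite_metrics_def mdiameter_le_iff X)
  qed
  define C where "C k = isometry_rel R `` {X k}" for k
  have C: "C k \<in> GH_space R" "X k \<in> C k" for k
    using finX equiv_class_self[OF equiv_isometry_rel]
    by (auto simp: C_def GH_space_def intro: quotientI)
  have dist_eq: "GH_class_dist (C k) (C l) = GH_dist (X k) (X l)" for k l
    by (rule GH_class_dist_eq[OF C(1) C(1) C(2) C(2)])
  have upper: "GH_class_dist (C k) (C l) \<le> u" for k l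
    using GH_dist_le_hausdorff_dist[OF fin fin emb emb, of k l] hausdorff_dist_comb_le[OF u, of m k l]
    by (simp add: dist_eq X)
  have lower: "u / 2 \<le> GH_class_dist (C k) (C l)" if "k < m" "k \<noteq> l" for k l
    unfolding dist_eq
  proof (rule GH_dist_ge[OF fin fin emb emb])
    \<comment> \<open>The endpoints of the distinguishing distance \<open>u * (8 * k + 5)\<close>;
      \<open>k < m\<close> ensures that the shifted tooth is present.\<close>
    show "0 \<in> mspace (X k)" "comb_pt k k \<in> mspace (X k)"
      using that by (auto simp: X comb_def)
    fix y y' assume "y \<in> mspace (X l)" "y' \<in> mspace (X l)"
    \<comment> \<open>Distinct integers differ by at least 1, which scales to a gap of
      \<open>u\<close>.\<close>
    then have "1 \<le> \<bar>8 * int k + 5 - \<bar>int y - int y'\<bar>\<bar>"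
      using comb_distance_unique[OF that(2), of y m y'] by (simp add: X)
    then have "1 \<le> \<bar>8 * real k + 5 - \<bar>real y - real y'\<bar>\<bar>"
      by linarith
    then have "u * 1 \<le> u * \<bar>8 * real k + 5 - \<bar>real y - real y'\<bar>\<bar>"
      using u by (intro mult_left_mono) auto
    also have "\<dots> = \<bar>u * (8 * real k + 5) - u * \<bar>real y - real y'\<bar>\<bar>"
      using u by (simp add: abs_mult flip: right_diff_distrib)
    finally show "2 * (u / 2) \<le> \<bar>mdist (X k) 0 (comb_pt k k) - mdist (X l) y y'\<bar>"
      by (simp add: X comb_pt_def add.commute)
  qed
  \<comment> \<open>At scale \<open>t = a * (u / 2)\<close> some pair must violate one of the two
    bounds, yet \<open>lower\<close> and \<open>upper\<close> with the Lipschitz inequalities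
    enforce both.\<close>
  obtain i j where ij: "i < m" "i \<noteq> j"
    and "dist (\<psi> (C i)) (\<psi> (C j)) < a * (u / 2) \<or>
      2 * b / a * (a * (u / 2)) < dist (\<psi> (C i)) (\<psi> (C j))"
    using m[rule_format, of "a * (u / 2)" "\<lambda>k. \<psi> (C k)"] ab u by auto
  then have "dist (\<psi> (C i)) (\<psi> (C j)) < a * (u / 2) \<or> b * u < dist (\<psi> (C i)) (\<psi> (C j))"
    using ab by simp
  moreover have "a * (u / 2) \<le> a * GH_class_dist (C i) (C j)"
    using lower[OF ij] ab by (intro mult_left_mono) auto
  moreover have "b * GH_class_dist (C i) (C j) \<le> b * u"
    using upper ab by (intro mult_left_mono) auto
  ultimately show False
    using lip[OF C(1) C(1), of i j] by linarith
qed

end
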